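(* Let $n\ge 1$. The basis $\mathbf\Omega=\{\omega_\pi\}_{\pi\in S_n}$ of the Hecke algebra $\mathscr H_n(z)$ consisting of positive permutation braids is orthonormal with respect to the right inner product; that is, for all $\pi,\kappa\in S_n$, $\langle \omega_\pi,\omega_\kappa\rangle_R = 1$ if $\pi=\kappa$, and $\langle \omega_\pi,\omega_\kappa\rangle_R=0$ if $\pi\neq\kappa$.
   Context: $B_n$ is Artin's braid group with generators $\sigma_1,\dots,\sigma_{n-1}$ and relations $\sigma_i\sigma_j=\sigma_j\sigma_i$ for $|i-j|\ge 2$, $\sigma_i\sigma_{i+1}\sigma_i=\sigma_{i+1}\sigma_i\sigma_{i+1}$. The Hecke algebra $\mathscr H_n(z)$ is the $\mathbf Z[z]$-algebra generated by $\sigma_1,\dots,\sigma_{n-1}$ (invertible) subject to these relations and $\sigma_i-\sigma_i^{-1}=z$ for all $i$. It is a free $\mathbf Z[z]$-module of rank $n!$. A braid $\beta\in B_n$ and its image in $\mathscr H_n(z)$ are denoted by the same symbol. Ocneanu's trace $\mathrm{Tr}$ is the family of $\mathbf Z[z]$-linear maps $\mathscr H_n(z)\to\mathbf Z[z,T]$, $n\ge1$, compatible with the inclusions $\mathscr H_n(z)\subset\mathscr H_{n+1}(z)$ and characterized by $\mathrm{Tr}(1)=1$, $\mathrm{Tr}(ab)=\mathrm{Tr}(ba)$, and $\mathrm{Tr}(x\sigma_n)=T\,\mathrm{Tr}(x)$ for $x\in\mathscr H_n(z)$. The framed Homfly polynomial of $\beta\in B_n$ is $$H_\beta(v,z)=\left(\frac{v^{-1}-v}{z}\right)^{n-1}\cdot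 \mathrm{Tr}(\beta)\Big|_{T=\frac{z}{1-v^2}},$$ a Laurent polynomial in $v$ and $z$. For $\beta\in B_n$, $\beta^*$ is the braid obtained by writing the letters of a braid word representing $\beta$ in reverse order (letters $\sigma_i^{\pm1}$ keep their exponents). The right inner product of $\alpha,\beta\in B_n$ is $$\langle\alpha,\beta\rangle_R=(-z)^{n-1}\cdot(\text{the coefficient of }v^{n-1}\text{ in }H_{\alpha\beta^*}(v,z));$$ it extends to a $\mathbf Z[z]$-bilinear form on $\mathscr H_n(z)$ with values in $\mathbf Z[z]$. For $\pi\in S_n$, with a reduced expression $\pi=s_{i_1}\cdots s_{i_k}$ in the adjacent transpositions $s_i=(i\ i+1)$, the positive permutation braid of $\pi$ is $\omega_\pi=\sigma_{i_1}\cdots\sigma_{i_k}\in B_n$ (independent of the reduced expression). The set $\mathbf\Omega=\{\omega_\pi\}_{\pi\in S_n}$ is a $\mathbf Z[z]$-basis of $\mathscr H_n(z)$. *)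

theory Defs
  imports
    "HOL-Library.Poly_Mapping"
    "HOL-Combinatorics.Permutations"
    "HOL-Computational_Algebra.Polynomial"
    "HOL-Computational_Algebra.Fraction_Field"
    "HOL-Computational_Algebra.Formal_Laurent_Series"
    "HOL-Algebra.QuotRing"
begin

text \<open>\<open>Sig i\<close> is the generator \<open>\<sigma>\<^sub>i\<close>, \<open>SigInv i\<close> its inverse.\<close>

datatype letter = Sig nat | SigInv nat

type_synonym word = "letter list"

definition words :: "nat \<Rightarrow> word set" where
  "words n = lists (Sig ` {1..<n} \<union> SigInv ` {1..<n})"

inductive_set braid_relations :: "nat \<Rightarrow> (word \<times> word) set" for n :: nat where
  inv_right: "i \<in> {1..<n} \<Longrightarrow> ([Sig i, SigInv i], []) \<in> braid_relations n"
| inv_left: "i \<in> {1..<n} \<Longrightarrow> ([SigInv i, Sig i], []) \<in> braid_relations n"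
| far_comm: "i \<in> {1..<n} \<Longrightarrow> j \<in> {1..<n} \<Longrightarrow> i + 2 \<le> j \<or> j + 2 \<le> i \<Longrightarrow>
    ([Sig i, Sig j], [Sig j, Sig i]) \<in> braid_relations n"
| braid: "i \<in> {1..<n} \<Longrightarrow> Suc i \<in> {1..<n} \<Longrightarrow>
    ([Sig i, Sig (Suc i), Sig i], [Sig (Suc i), Sig i, Sig (Suc i)]) \<in> braid_relations n"

inductive_set braid_cong :: "nat \<Rightarrow> (word \<times> word) set" for n :: nat where
  refl: "w \<in> words n \<Longrightarrow> (w, w) \<in> braid_cong n"
| sym: "(u, w) \<in> braid_cong n \<Longrightarrow> (w, u) \<in> braid_cong n"
| trans: "(u, v) \<in> braid_cong n \<Longrightarrow> (v, w) \<in> braid_cong n \<Longrightarrow> (u, w) \<in> braid_cong n"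
| rel: "(l, r) \<in> braid_relations n \<Longrightarrow> u \<in> words n \<Longrightarrow> v \<in> words n \<Longrightarrow>
    (u @ l @ v, u @ r @ v) \<in> braid_cong n"

type_synonym braid = "word set"

definition braid_of :: "nat \<Rightarrow> word \<Rightarrow> braid" where
  "braid_of n w = braid_cong n `` {w}"

definition braid_group :: "nat \<Rightarrow> braid monoid" where
  "braid_group n =
    \<lparr>carrier = words n // braid_cong n,
     mult = (\<lambda>\<alpha> \<beta>. \<Union>u\<in>\<alpha>. \<Union>w\<in>\<beta>. braid_of n (u @ w)),
     one = braid_of n []\<rparr>"

text \<open>The relations are preserved by reading words backwards, so the reversals of all words
  representing \<open>\<beta>\<close> again form one braid.\<close>

definition braid_reverse :: "braid \<Rightarrow> braid" where
  "braid_reverse \<beta> = rev ` \<beta>"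

definition perm_of :: "nat list \<Rightarrow> nat \<Rightarrow> nat" where
  "perm_of is = foldr (\<lambda>i p. transpose i (Suc i) \<circ> p) is id"

definition reduced_expression :: "nat \<Rightarrow> (nat \<Rightarrow> nat) \<Rightarrow> nat list \<Rightarrow> bool" where
  "reduced_expression n \<pi> is \<longleftrightarrow>
    set is \<subseteq> {1..<n} \<and> perm_of is = \<pi> \<and>
    (\<forall>js. set js \<subseteq> {1..<n} \<and> perm_of js = \<pi> \<longrightarrow> length is \<le> length js)"

text \<open>The braid does not depend on the chosen reduced expression (Matsumoto).\<close>

definition pos_perm_braid :: "nat \<Rightarrow> (nat \<Rightarrow> nat) \<Rightarrow> braid" where
  "pos_perm_braid n \<pi> = braid_of n (map Sig (SOME is. reduced_expression n \<pi> is))"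

text \<open>Words under concatenation are the free monoid. This makes \<open>word \<Rightarrow>\<^sub>0 int poly\<close> the free
  associative algebra over \<open>\<int>[z]\<close> on the letters, where \<open>z\<close> is the variable of \<open>int poly\<close>.\<close>

instantiation list :: (type) monoid_add
begin

definition zero_list :: "'a list" where "zero_list = []"

definition plus_list :: "'a list \<Rightarrow> 'a list \<Rightarrow> 'a list" where "plus_list u w = u @ w"

instance
  by standard (simp_all add: zero_list_def plus_list_def)

end

abbreviation zvar :: "int poly" where
  "zvar \<equiv> [:0, 1:]"

type_synonym free_elem = "word \<Rightarrow>\<^sub>0 int poly"

definition free_algebra :: "nat \<Rightarrow> free_elem ring" where
  "free_algebra n =
    \<lparr>carrier = {f. Poly_Mapping.keys f \<subseteq> words n},
     mult = (*), one = 1, zero = 0, add = (+)\<rparr>"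

abbreviation free_word :: "word \<Rightarrow> free_elem" where
  "free_word w \<equiv> Poly_Mapping.single w 1"

abbreviation free_const :: "int poly \<Rightarrow> free_elem" where
  "free_const c \<equiv> Poly_Mapping.single [] c"

definition hecke_relators :: "nat \<Rightarrow> free_elem set" where
  "hecke_relators n =
    {free_word l - free_word r | l r. (l, r) \<in> braid_relations n} \<union>
    {free_word [Sig i] - free_word [SigInv i] - free_const zvar | i. i \<in> {1..<n}}"

definition hecke_ideal :: "nat \<Rightarrow> free_elem set" where
  "hecke_ideal n = Idl\<^bsub>free_algebra n\<^esub> (hecke_relators n)"

type_synonym hecke_elem = "free_elem set"

definition hecke :: "nat \<Rightarrow> hecke_elem ring" where
  "hecke n = free_algebra n Quot hecke_ideal n"

definition hecke_of :: "nat \<Rightarrow> free_elem \<Rightarrow> hecke_elem" where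
  "hecke_of n f = hecke_ideal n +>\<^bsub>free_algebra n\<^esub> f"

definition hecke_smult :: "nat \<Rightarrow> int poly \<Rightarrow> hecke_elem \<Rightarrow> hecke_elem" where
  "hecke_smult n c x = hecke_of n (free_const c) \<otimes>\<^bsub>hecke n\<^esub> x"

text \<open>On cosets and braids, respectively, all members of the following unions are the same
  coset of the target ideal.\<close>

definition hecke_incl :: "nat \<Rightarrow> hecke_elem \<Rightarrow> hecke_elem" where
  "hecke_incl n x = (\<Union>f\<in>x. hecke_of (Suc n) f)"

definition hecke_of_braid :: "nat \<Rightarrow> braid \<Rightarrow> hecke_elem" where
  "hecke_of_braid n \<beta> = (\<Union>w\<in>\<beta>. hecke_of n (free_word w))"

text \<open>\<open>int poly poly\<close> is \<open>\<int>[z,T]\<close> with outer variable \<open>T\<close>. Only the values \<open>Tr n x\<close> with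
  \<open>n \<ge> 1\<close> and \<open>x \<in> H\<^sub>n\<close> are relevant.\<close>

definition ocneanu_trace :: "(nat \<Rightarrow> hecke_elem \<Rightarrow> int poly poly) \<Rightarrow> bool" where
  "ocneanu_trace Tr \<longleftrightarrow> (\<forall>n\<ge>1.
    (\<forall>x\<in>carrier (hecke n). \<forall>y\<in>carrier (hecke n).
      Tr n (x \<oplus>\<^bsub>hecke n\<^esub> y) = Tr n x + Tr n y) \<and>
    (\<forall>c. \<forall>x\<in>carrier (hecke n). Tr n (hecke_smult n c x) = smult c (Tr n x)) \<and>
    (\<forall>x\<in>carrier (hecke n). Tr (Suc n) (hecke_incl n x) = Tr n x) \<and>
    Tr n \<one>\<^bsub>hecke n\<^esub> = 1 \<and>
    (\<forall>x\<in>carrier (hecke n). \<forall>y\<in>carrier (hecke n).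
      Tr n (x \<otimes>\<^bsub>hecke n\<^esub> y) = Tr n (y \<otimes>\<^bsub>hecke n\<^esub> x)) \<and>
    (\<forall>x\<in>carrier (hecke n).
      Tr (Suc n) (hecke_incl n x \<otimes>\<^bsub>hecke (Suc n)\<^esub> hecke_of (Suc n) (free_word [Sig n])) =
        [:0, 1:] * Tr n x))"

text \<open>Laurent polynomials in \<open>v\<close> and \<open>z\<close> are viewed inside the field \<open>\<rat>(z)((v))\<close> of formal
  Laurent series in \<open>v\<close> over the fraction field of \<open>\<int>[z]\<close>. Here \<open>1 - v\<^sup>2\<close> is invertible, and a
  Laurent polynomial keeps its coefficients with respect to \<open>v\<close>.\<close>

definition embed_z :: "int poly \<Rightarrow> int poly fract" where
  "embed_z p = Fraction_Field.Fract p 1"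

definition framed_homfly ::
    "(nat \<Rightarrow> hecke_elem \<Rightarrow> int poly poly) \<Rightarrow> nat \<Rightarrow> braid \<Rightarrow> int poly fract fls" where
  "framed_homfly Tr n \<beta> =
    (let v = fls_X; z = fls_const (embed_z zvar) in
      ((inverse v - v) / z) ^ (n - 1) *
      poly (map_poly (\<lambda>c. fls_const (embed_z c)) (Tr n (hecke_of_braid n \<beta>))) (z / (1 - v\<^sup>2)))"

definition right_inner ::
    "(nat \<Rightarrow> hecke_elem \<Rightarrow> int poly poly) \<Rightarrow> nat \<Rightarrow> braid \<Rightarrow> braid \<Rightarrow> int poly fract" where
  "right_inner Tr n \<alpha> \<beta> =
    (- embed_z zvar) ^ (n - 1) *
    fls_nth (framed_homfly Tr n (\<alpha> \<otimes>\<^bsub>braid_group n\<^esub> braid_reverse \<beta>)) (int (n - 1))"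

end

(* Substituting T = z/(1 - v^2), the monomial T^k contributes (1 - v^2)^(n-1-k), up to powers of z,
   to (v z)^(n-1) H. As Tr has T-degree at most n - 1, the coefficient of v^(2(n-1)) only sees k = 0,
   so the inner product is the constant term in T of Tr(alpha rev(beta)).
   At T = 0 the trace kills every normal form w (s_m s_(m-1) ... s_j) with a nontrivial last factor,
   by cyclicity and the Markov property, so it is the coefficient of the identity in the basis of
   normal forms. Orthonormality follows by moving the letters of rev(beta) one by one to alpha: either
   the length of alpha grows, or s^2 = 1 + z s, whose z-term vanishes because a permutation cannot
   both have and lack a descent at s. *)

theory Submission
  imports Defs "HOL-Computational_Algebra.Polynomial_FPS"
begin

section \<open>Combinatorics of positive words modulo braid moves, without inverses or the quadratic
  relation\<close>

section \<open>Braid moves and normal forms of positive words\<close>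

text \<open>No strand number appears: every move preserves the set of letters, so a word on n
  strands stays one. Every move also preserves the length, which makes arguments on reduced words
  possible.\<close>

inductive braid_eq :: "nat list \<Rightarrow> nat list \<Rightarrow> bool" where
  refl: "braid_eq u u"
| sym: "braid_eq u v \<Longrightarrow> braid_eq v u"
| trans: "braid_eq u v \<Longrightarrow> braid_eq v w \<Longrightarrow> braid_eq u w"
| far: "i + 2 \<le> j \<Longrightarrow> braid_eq (u @ [i, j] @ v) (u @ [j, i] @ v)"
| braid: "braid_eq (u @ [i, Suc i, i] @ v) (u @ [Suc i, i, Suc i] @ v)"

lemma braid_eq_context: "braid_eq u v \<Longrightarrow> braid_eq (x @ u @ y) (x @ v @ y)"
proof (induction rule: braid_eq.induct)
  case (far i j u v)
  then show ?case using braid_eq.far[of i j "x @ u" "v @ y"] by simp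
next
  case (braid u i v)
  show ?case using braid_eq.braid[of "x @ u" i "v @ y"] by simp
qed (blast intro: braid_eq.intros)+

lemma braid_eq_append: "braid_eq u v \<Longrightarrow> braid_eq u' v' \<Longrightarrow> braid_eq (u @ u') (v @ v')"
  using braid_eq_context[of u v "[]" u'] braid_eq_context[of u' v' v "[]"]
  by (auto intro: braid_eq.trans)

lemma braid_eq_length: "braid_eq u v \<Longrightarrow> length u = length v"
  by (induction rule: braid_eq.induct) auto

lemma braid_eq_set: "braid_eq u v \<Longrightarrow> set u = set v"
  by (induction rule: braid_eq.induct) auto

lemma perm_of_Nil [simp]: "perm_of [] = id"
  by (simp add: perm_of_def)

lemma perm_of_Cons [simp]: "perm_of (i # u) = transpose i (Suc i) \<circ> perm_of u"
  by (simp add: perm_of_def)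

lemma perm_of_append [simp]: "perm_of (u @ v) = perm_of u \<circ> perm_of v"
  by (induction u) (simp_all add: comp_assoc)

lemma bij_perm_of: "bij (perm_of u)"
  by (induction u) (simp_all only: perm_of_Nil perm_of_Cons bij_id bij_comp bij_transpose)

lemma braid_eq_perm_of: "braid_eq u v \<Longrightarrow> perm_of u = perm_of v"
proof (induction rule: braid_eq.induct)
  case (far i j u v)
  then have "perm_of [i, j] = perm_of [j, i]"
    by (auto simp: fun_eq_iff transpose_def)
  then show ?case by (simp only: perm_of_append)
next
  case (braid u i v)
  have "perm_of [i, Suc i, i] = perm_of [Suc i, i, Suc i]"
    by (auto simp: fun_eq_iff transpose_def)
  then show ?case by (simp only: perm_of_append)
qed auto

lemma perm_of_square: "perm_of [s, s] = id"
  by simp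

lemma perm_of_permutes: "set u \<subseteq> {1..<n} \<Longrightarrow> perm_of u permutes {1..n}"
  by (induction u) (auto intro!: permutes_compose permutes_swap_id permutes_id)

lemma far_sym: "i + 2 \<le> j \<or> j + 2 \<le> i \<Longrightarrow> braid_eq (u @ [i, j] @ v) (u @ [j, i] @ v)"
  using braid_eq.far braid_eq.sym by metis

lemma braid_eq_commute:
  assumes "\<And>i. i \<in> set u \<Longrightarrow> i + 2 \<le> s \<or> s + 2 \<le> i"
  shows "braid_eq (u @ [s]) (s # u)"
  using assms
proof (induction u)
  case (Cons i u)
  have "braid_eq (i # u @ [s]) (i # s # u)"
    using braid_eq_context[of "u @ [s]" "s # u" "[i]" "[]"] Cons by simp
  moreover have "braid_eq (i # s # u) (s # i # u)"
    using far_sym[of i s "[]" u] Cons.prems[of i] by simp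
  ultimately show ?case by (auto intro: braid_eq.trans)
qed (simp add: braid_eq.refl)

section \<open>Normal forms built from descending runs\<close>

abbreviation descending :: "nat \<Rightarrow> nat \<Rightarrow> nat list" where
  "descending j m \<equiv> rev [j..<Suc m]"

lemma descending_commute_low:
  "Suc s < j \<Longrightarrow> braid_eq (descending j m @ [s]) (s # descending j m)"
  by (rule braid_eq_commute) auto

text \<open>The run is split around its adjacent letters \<open>Suc s\<close>, \<open>s\<close>. The
  new letter moves left past the small letters \<open>B\<close>, one braid move turns it into a
  leading \<open>s\<close>, and this \<open>s\<close> moves left past the large letters
  \<open>A\<close>.\<close>

lemma descending_commute_high:
  assumes "j < Suc s" "Suc s \<le> m"
  shows "braid_eq (descending j m @ [Suc s]) (s # descending j m)"
proof -
  define A where "A = descending (Suc (Suc s)) m"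
  define B where "B = rev [j..<s]"
  have "[j..<Suc m] = [j..<s] @ [s..<Suc m]"
    using assms by (metis Suc_leD le_SucI less_Suc_eq_le upt_add_eq_append le_Suc_ex)
  moreover have "[s..<Suc m] = s # Suc s # [Suc (Suc s)..<Suc m]"
    using assms by (simp add: upt_conv_Cons)
  ultimately have D: "descending j m = A @ [Suc s, s] @ B"
    unfolding A_def B_def by (simp del: upt_Suc)
  have "braid_eq (B @ [Suc s]) (Suc s # B)"
    unfolding B_def by (rule braid_eq_commute) auto
  from braid_eq_context[OF this, of "A @ [Suc s, s]" "[]"]
  have "braid_eq (A @ [Suc s, s] @ B @ [Suc s]) (A @ [Suc s, s, Suc s] @ B)" by simp
  moreover have "braid_eq (A @ [Suc s, s, Suc s] @ B) (A @ [s, Suc s, s] @ B)"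
    by (blast intro: braid_eq.braid braid_eq.sym)
  moreover have "braid_eq (A @ [s]) (s # A)"
    unfolding A_def by (rule braid_eq_commute) auto
  from braid_eq_context[OF this, of "[]" "[Suc s, s] @ B"]
  have "braid_eq (A @ [s, Suc s, s] @ B) (s # A @ [Suc s, s] @ B)" by simp
  ultimately show ?thesis unfolding D by (auto intro: braid_eq.trans)
qed

text \<open>The set for n uses the letters 1 to n - 1 and corresponds to S_n. Each run represents a
  coset of S_m in S_(m+1); for j = \<open>Suc m\<close> the run is empty and represents the trivial
  coset.\<close>

primrec normal_forms :: "nat \<Rightarrow> nat list set" where
  "normal_forms 0 = {[]}"
| "normal_forms (Suc m) = {w @ descending j m | w j. w \<in> normal_forms m \<and> j \<in> {1..Suc m}}"

lemma normal_forms_set: "w \<in> normal_forms n \<Longrightarrow> set w \<subseteq> {1..<n}"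
proof (induction n arbitrary: w)
  case (Suc m)
  then obtain w' j where "w = w' @ descending j m" "w' \<in> normal_forms m" "j \<in> {1..Suc m}" by auto
  then show ?case using Suc.IH[of w'] by force
qed simp

lemma Nil_in_normal_forms: "[] \<in> normal_forms n"
  by (induction n) force+

text \<open>Only the last run has to be compared with s: the letter extends it, is its final letter,
  or passes through it to be treated by induction. The second alternative says that s is a right
  descent of w.\<close>

lemma normal_form_mult:
  assumes "w \<in> normal_forms n" "s \<in> {1..<n}"
  shows "(\<exists>w' \<in> normal_forms n. braid_eq (w @ [s]) w') \<or>
    (\<exists>w' \<in> normal_forms n. braid_eq w (w' @ [s]))"
  using assms
proof (induction n arbitrary: w s)
  case (Suc m)
  then obtain v j where w: "w = v @ descending j m" and v: "v \<in> normal_forms m"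
    and j: "j \<in> {1..Suc m}" by auto
  \<comment> \<open>A letter that leaves the last run on its left as s' multiplies the shorter
    normal form v. Both alternatives for v and s' carry over to w and s.\<close>
  have shift: ?case
    if s': "s' \<in> {1..<m}" and comm: "braid_eq (descending j m @ [s]) (s' # descending j m)" for s'
    using Suc.IH[OF v s']
  proof (elim disjE bexE)
    fix v' assume v': "v' \<in> normal_forms m" "braid_eq (v @ [s']) v'"
    have "braid_eq (w @ [s]) (v @ s' # descending j m)"
      using braid_eq_context[OF comm, of v "[]"] by (simp add: w)
    moreover have "braid_eq (v @ s' # descending j m) (v' @ descending j m)"
      using braid_eq_context[OF v'(2), of "[]" "descending j m"] by simp
    ultimately have "braid_eq (w @ [s]) (v' @ descending j m)" by (rule braid_eq.trans)
    moreover have "v' @ descending j m \<in> normal_forms (Suc m)" using v' j by auto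
    ultimately show ?case by blast
  next
    fix v' assume v': "v' \<in> normal_forms m" "braid_eq v (v' @ [s'])"
    have "braid_eq w (v' @ s' # descending j m)"
      using braid_eq_context[OF v'(2), of "[]" "descending j m"] by (simp add: w)
    moreover have "braid_eq (v' @ s' # descending j m) ((v' @ descending j m) @ [s])"
      using braid_eq_context[OF braid_eq.sym[OF comm], of v' "[]"] by simp
    ultimately have "braid_eq w ((v' @ descending j m) @ [s])" by (rule braid_eq.trans)
    moreover have "v' @ descending j m \<in> normal_forms (Suc m)" using v' j by auto
    ultimately show ?case by blast
  qed
  \<comment> \<open>In turn: s passes the run unchanged, s extends the run, s is the last letter of
    the run, and s passes the run and comes out as s - 1.\<close>
  consider "Suc s < j" | "Suc s = j" | "s = j" | "j < s" by linarith
  then show ?case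
  proof cases
    case 1
    show ?thesis
      by (rule shift[OF _ descending_commute_low[OF 1]]) (use 1 j Suc.prems in auto)
  next
    case 2
    then have "w @ [s] = v @ descending s m"
      using j by (simp add: w upt_conv_Cons del: upt_Suc)
    moreover have "s \<in> {1..Suc m}" using Suc.prems by auto
    ultimately have "w @ [s] \<in> normal_forms (Suc m)"
      using v by auto
    then show ?thesis by (blast intro: braid_eq.refl)
  next
    case 3
    then have "w = (v @ descending (Suc s) m) @ [s]"
      using Suc.prems by (simp add: w upt_conv_Cons del: upt_Suc)
    moreover have "Suc s \<in> {1..Suc m}" using Suc.prems by auto
    then have "v @ descending (Suc s) m \<in> normal_forms (Suc m)"
      using v by auto
    ultimately show ?thesis by (metis braid_eq.refl)
  next
    case 4
    then obtain s' where s': "s = Suc s'" by (cases s) auto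
    show ?thesis
      by (rule shift[of s']) (use descending_commute_high[of j s' m] 4 j Suc.prems s' in auto)
  qed
qed simp

section \<open>Normal forms as representatives of permutations\<close>

lemma perm_of_descending: "j \<le> Suc m \<Longrightarrow> perm_of (descending j m) j = Suc m"
proof (induction m)
  case 0
  then show ?case by (cases "j = 1") (auto simp: transpose_def)
next
  case (Suc m)
  then show ?case by (cases "j = Suc (Suc m)") (auto simp: transpose_def)
qed

text \<open>The rightmost letter acts first, so the last run carries j to the top point
  \<open>Suc m\<close>, which the remaining letters fix. Hence j is the preimage of the top point;
  cancelling the common run leaves the induction hypothesis.\<close>

lemma normal_form_unique:
  assumes "w \<in> normal_forms n" "w' \<in> normal_forms n" "perm_of w = perm_of w'"
  shows "w = w'"
  using assms
proof (induction n arbitrary: w w')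
  case (Suc m)
  obtain v j where w: "w = v @ descending j m" "v \<in> normal_forms m" "j \<in> {1..Suc m}"
    using Suc.prems by auto
  obtain v' j' where w': "w' = v' @ descending j' m" "v' \<in> normal_forms m" "j' \<in> {1..Suc m}"
    using Suc.prems by auto
  have last: "perm_of (u @ descending i m) i = Suc m"
    if "u \<in> normal_forms m" "i \<in> {1..Suc m}" for u i
    using that perm_of_descending[of i m]
      permutes_not_in[OF perm_of_permutes[OF normal_forms_set[OF that(1)]], of "Suc m"]
    by (simp del: upt_Suc)
  have "perm_of w j = perm_of w j'"
    using last[OF w(2,3)] last[OF w'(2,3)] Suc.prems(3) w(1) w'(1) by metis
  then have j: "j = j'" using bij_perm_of[of w] by (meson bij_is_inj injD)
  have "perm_of v \<circ> perm_of (descending j m) = perm_of v' \<circ> perm_of (descending j m)"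
    using Suc.prems(3) unfolding w(1) w'(1) j perm_of_append .
  then have "perm_of v = perm_of v'"
    using bij_perm_of by (metis bij_is_surj surj_fun_eq)
  then have "v = v'" by (rule Suc.IH[OF w(2) w'(2)])
  then show ?case using w(1) w'(1) j by simp
qed simp

text \<open>The last run is forced to start from the preimage j of the top point. Dividing by its
  permutation leaves a permutation that fixes the top point and so lies in S_m.\<close>

lemma normal_form_exists:
  assumes "\<pi> permutes {1..n}"
  shows "\<exists>w \<in> normal_forms n. perm_of w = \<pi>"
  using assms
proof (induction n arbitrary: \<pi>)
  case 0
  then show ?case by (simp add: permutes_empty)
next
  case (Suc m)
  define j where "j = Hilbert_Choice.inv \<pi> (Suc m)"
  have j: "j \<in> {1..Suc m}"
    unfolding j_def using permutes_in_image[OF permutes_inv[OF Suc.prems], of "Suc m"] by auto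
  have pj: "\<pi> j = Suc m"
    unfolding j_def by (rule permutes_inverses(1)[OF Suc.prems])
  let ?d = "perm_of (descending j m)"
  have d: "?d permutes {1..Suc m}"
    by (rule perm_of_permutes) (use j in auto)
  define \<rho> where "\<rho> = \<pi> \<circ> Hilbert_Choice.inv ?d"
  have "Hilbert_Choice.inv ?d (Suc m) = j"
    using perm_of_descending[of j m] j permutes_inverses(2)[OF d, of j] by (simp del: upt_Suc)
  then have fix_top: "\<rho> (Suc m) = Suc m" by (simp add: \<rho>_def pj)
  have "\<rho> permutes {1..Suc m}"
    unfolding \<rho>_def by (intro permutes_compose permutes_inv d Suc.prems)
  then have "\<rho> permutes {1..m}"
    by (rule permutes_superset) (use fix_top in \<open>auto simp: le_Suc_eq\<close>)
  then obtain w where w: "w \<in> normal_forms m" "perm_of w = \<rho>" using Suc.IH by blast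
  have "perm_of (w @ descending j m) = \<pi>"
    using permutes_inv_o(2)[OF d] by (simp add: w \<rho>_def comp_assoc del: upt_Suc)
  moreover have "w @ descending j m \<in> normal_forms (Suc m)" using w(1) j by auto
  ultimately show ?case by blast
qed

section \<open>Reduced expressions\<close>

lemma reduced_expression_exists:
  assumes "\<pi> permutes {1..n}"
  shows "\<exists>u. reduced_expression n \<pi> u"
proof -
  let ?P = "\<lambda>u. set u \<subseteq> {1..<n} \<and> perm_of u = \<pi>"
  obtain w where "?P w"
    using normal_form_exists[OF assms] normal_forms_set by blast
  \<comment> \<open>Lengths are natural numbers, so a shortest word exists as soon as some word,
    here a normal form, represents the permutation.\<close>
  then have "?P (arg_min length ?P) \<and> (\<forall>y. ?P y \<longrightarrow> length (arg_min length ?P) \<le> length y)"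
    using arg_min_nat_lemma[of ?P w length] by blast
  then show ?thesis unfolding reduced_expression_def by blast
qed

lemma reduced_expression_snocD:
  assumes "reduced_expression n (perm_of (u @ [s])) (u @ [s])"
  shows "reduced_expression n (perm_of u) u"
  unfolding reduced_expression_def
proof (intro conjI allI impI HOL.refl)
  show "set u \<subseteq> {1..<n}" using assms by (simp add: reduced_expression_def)
  fix v assume v: "set v \<subseteq> {1..<n} \<and> perm_of v = perm_of u"
  then have "set (v @ [s]) \<subseteq> {1..<n}" "perm_of (v @ [s]) = perm_of (u @ [s])"
    using assms by (simp_all add: reduced_expression_def)
  then have "length (u @ [s]) \<le> length (v @ [s])"
    using assms unfolding reduced_expression_def by blast
  then show "length u \<le> length v" by simp
qed

text \<open>If u could be rewritten to end in s, then the two letters s of \<open>u @ [s]\<close>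
  would cancel and w would represent the same permutation with two letters fewer.\<close>

lemma reduced_expression_no_cancel:
  assumes "reduced_expression n (perm_of (u @ [s])) (u @ [s])" "set w \<subseteq> {1..<n}"
  shows "\<not> braid_eq u (w @ [s])"
proof
  assume *: "braid_eq u (w @ [s])"
  have "perm_of (u @ [s]) = perm_of w \<circ> perm_of [s, s]"
    using braid_eq_perm_of[OF *] by (simp add: comp_assoc)
  then have "perm_of w = perm_of (u @ [s])" by simp
  then have "length (u @ [s]) \<le> length w"
    using assms unfolding reduced_expression_def by blast
  then show False using braid_eq_length[OF *] by simp
qed

text \<open>Letters are appended one at a time; the descent alternative of
  \<open>normal_form_mult\<close> would contradict reducedness. With uniqueness of normal forms this
  contains Matsumoto's theorem: braid moves alone connect reduced words of one permutation.\<close>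

lemma reduced_expression_normal_form:
  assumes "reduced_expression n (perm_of u) u"
  shows "\<exists>w \<in> normal_forms n. braid_eq u w"
  using assms
proof (induction u rule: rev_induct)
  case Nil
  then show ?case using Nil_in_normal_forms braid_eq.refl by blast
next
  case (snoc s u)
  obtain w where w: "w \<in> normal_forms n" "braid_eq u w"
    using snoc.IH reduced_expression_snocD[OF snoc.prems] by blast
  have s: "s \<in> {1..<n}" using snoc.prems by (simp add: reduced_expression_def)
  from normal_form_mult[OF w(1) s] show ?case
  proof (elim disjE bexE)
    fix w' assume w': "w' \<in> normal_forms n" "braid_eq (w @ [s]) w'"
    have "braid_eq (u @ [s]) (w @ [s])"
      using braid_eq_append[OF w(2) braid_eq.refl] .
    then show ?case using w' by (blast intro: braid_eq.trans)
  next
    fix w' assume w': "w' \<in> normal_forms n" "braid_eq w (w' @ [s])"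
    have False
      using reduced_expression_no_cancel[OF snoc.prems normal_forms_set[OF w'(1)]]
        braid_eq.trans[OF w(2) w'(2)] by simp
    then show ?case ..
  qed
qed

section \<open>Evaluation of a Markov trace on positive words\<close>

section \<open>Traces on positive words\<close>

text \<open>These axioms isolate what the combinatorics uses of Ocneanu's trace, so that neither
  cosets nor inverse letters occur in it. The axiom \<open>quadratic\<close> is the skein relation
  multiplied by the generator, and the polynomial variable is T.\<close>

locale word_trace =
  fixes F :: "nat \<Rightarrow> nat list \<Rightarrow> 'a::comm_ring_1 poly" and z :: 'a
  assumes far: "\<lbrakk>n \<ge> 1; set (u @ [i, j] @ v) \<subseteq> {1..<n}; i + 2 \<le> j\<rbrakk> \<Longrightarrow>
      F n (u @ [i, j] @ v) = F n (u @ [j, i] @ v)"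
    and braid: "\<lbrakk>n \<ge> 1; set (u @ [i, Suc i, i] @ v) \<subseteq> {1..<n}\<rbrakk> \<Longrightarrow>
      F n (u @ [i, Suc i, i] @ v) = F n (u @ [Suc i, i, Suc i] @ v)"
    and quadratic: "\<lbrakk>n \<ge> 1; set (u @ [i, i] @ v) \<subseteq> {1..<n}\<rbrakk> \<Longrightarrow>
      F n (u @ [i, i] @ v) = F n (u @ v) + smult z (F n (u @ [i] @ v))"
    and cyclic: "\<lbrakk>n \<ge> 1; set (u @ v) \<subseteq> {1..<n}\<rbrakk> \<Longrightarrow> F n (u @ v) = F n (v @ u)"
    and inclusion: "\<lbrakk>n \<ge> 1; set u \<subseteq> {1..<n}\<rbrakk> \<Longrightarrow> F (Suc n) u = F n u"
    and markov: "\<lbrakk>n \<ge> 1; set u \<subseteq> {1..<n}\<rbrakk> \<Longrightarrow> F (Suc n) (u @ [n]) = [:0, 1:] * F n u"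
    and empty: "n \<ge> 1 \<Longrightarrow> F n [] = 1"
begin

lemma braid_eq_invariant:
  assumes "n \<ge> 1" "braid_eq u v" "set u \<subseteq> {1..<n}"
  shows "F n u = F n v"
  using assms(2,3)
proof (induction rule: braid_eq.induct)
  case (sym u v)
  then show ?case using braid_eq_set by metis
next
  case (trans u v w)
  then show ?case using braid_eq_set by metis
next
  case (far i j u v)
  then show ?case using word_trace.far[OF word_trace_axioms assms(1)] by blast
next
  case (braid u i v)
  then show ?case using word_trace.braid[OF word_trace_axioms assms(1)] by blast
qed simp

text \<open>Cyclicity rotates the only occurrence of the top letter n to the end, where the Markov
  property applies.\<close>

lemma markov_conj:
  assumes "n \<ge> 1" "set (u @ v) \<subseteq> {1..<n}"
  shows "F (Suc n) (u @ n # v) = [:0, 1:] * F n (v @ u)"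
proof -
  have "F (Suc n) (u @ n # v) = F (Suc n) ((u @ [n]) @ v)" by simp
  also have "\<dots> = F (Suc n) (v @ u @ [n])"
    by (rule cyclic) (use assms in auto)
  also have "\<dots> = [:0, 1:] * F n (v @ u)"
    using markov[of n "v @ u"] assms by auto
  finally show ?thesis .
qed

text \<open>This is the multiplication rule of the basis of normal forms, seen through the trace. In
  the case \<open>down\<close>, w = w' s, so w s = w' s^2 = w' + z w.\<close>

lemma mult_cases:
  assumes "n \<ge> 1" "w \<in> normal_forms n" "set (s # u) \<subseteq> {1..<n}"
  obtains (up) w' where "w' \<in> normal_forms n" "braid_eq (w @ [s]) w'"
      "F n (w @ s # u) = F n (w' @ u)"
    | (down) w' where "w' \<in> normal_forms n" "braid_eq w (w' @ [s])"
      "F n (w @ s # u) = F n (w' @ u) + smult z (F n (w @ u))"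
proof -
  have w: "set w \<subseteq> {1..<n}" by (rule normal_forms_set[OF assms(2)])
  have s: "s \<in> {1..<n}" using assms(3) by simp
  from normal_form_mult[OF assms(2) s] show ?thesis
  proof (elim disjE bexE)
    fix w' assume w': "w' \<in> normal_forms n" "braid_eq (w @ [s]) w'"
    have "F n (w @ s # u) = F n (w' @ u)"
      using braid_eq_invariant[OF assms(1) braid_eq_context[OF w'(2), of "[]" u]] w assms(3)
      by simp
    then show ?thesis using up w' by blast
  next
    fix w' assume w': "w' \<in> normal_forms n" "braid_eq w (w' @ [s])"
    have w'_set: "set w' \<subseteq> {1..<n}" by (rule normal_forms_set[OF w'(1)])
    have "F n (w @ s # u) = F n (w' @ [s, s] @ u)"
      using braid_eq_invariant[OF assms(1) braid_eq_context[OF w'(2), of "[]" "s # u"]] w assms(3)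
      by simp
    also have "\<dots> = F n (w' @ u) + smult z (F n (w' @ [s] @ u))"
      by (rule quadratic[OF assms(1)]) (use w'_set assms(3) in auto)
    also have "F n (w' @ [s] @ u) = F n (w @ u)"
      using braid_eq_invariant[OF assms(1) braid_eq_context[OF w'(2), of "[]" u]] w assms(3)
      by simp
    finally show ?thesis using down w' by blast
  qed
qed

text \<open>The last run is empty, or it contains the top letter exactly once, as its first letter.
  In the second case \<open>markov_conj\<close> extracts a factor T.\<close>

lemma normal_form_cases:
  assumes "n \<ge> 1" "w \<in> normal_forms (Suc n)"
  obtains (lower) "w \<in> normal_forms n" "F (Suc n) w = F n w"
    | (top) u where "w \<noteq> []" "set u \<subseteq> {1..<n}" "F (Suc n) w = [:0, 1:] * F n u"
proof -
  obtain v j where w: "w = v @ descending j n" "v \<in> normal_forms n" "j \<in> {1..Suc n}"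
    using assms(2) by auto
  have v: "set v \<subseteq> {1..<n}" by (rule normal_forms_set[OF w(2)])
  show ?thesis
  proof (cases "j = Suc n")
    case True
    then have "w = v" using w(1) by simp
    then show ?thesis using lower w(2) inclusion[OF assms(1) v] by simp
  next
    case False
    then have w_eq: "w = v @ n # rev [j..<n]" using w by simp
    have low: "set (v @ rev [j..<n]) \<subseteq> {1..<n}" using v w(3) by auto
    have "F (Suc n) w = [:0, 1:] * F n (rev [j..<n] @ v)"
      unfolding w_eq by (rule markov_conj[OF assms(1) low])
    moreover have "set (rev [j..<n] @ v) \<subseteq> {1..<n}" using low by auto
    ultimately show ?thesis using top w_eq by blast
  qed
qed

section \<open>Degree in T, constant term in T, and orthonormality\<close>

lemma degree_le:
  assumes "n \<ge> 1" "set u \<subseteq> {1..<n}"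
  shows "degree (F n u) \<le> n - 1"
  using assms
proof (induction n arbitrary: u rule: dec_induct)
  case base
  then show ?case by (simp add: empty)
next
  case (step n)
  \<comment> \<open>A normal form prefix w is carried along and absorbs the letters of u one by one.
    Once u is exhausted, passing to one strand fewer costs at most one factor T.\<close>
  have main: "degree (F (Suc n) (w @ u)) \<le> n"
    if "w \<in> normal_forms (Suc n)" "set u \<subseteq> {1..<Suc n}" for w u
    using that
  proof (induction u arbitrary: w)
    case Nil
    from step.hyps(1) Nil(1) show ?case
    proof (cases rule: normal_form_cases)
      case lower
      then show ?thesis using step.IH[OF normal_forms_set] by fastforce
    next
      case (top u)
      then show ?thesis
        using step.IH[of u] step.hyps(1) degree_pCons_le[of 0 "F n u"] by simp
    qed
  next
    case (Cons s u)
    have u: "set u \<subseteq> {1..<Suc n}" using Cons.prems by simp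
    have "1 \<le> Suc n" by simp
    from this Cons.prems show ?case
    proof (cases rule: mult_cases)
      case (up w')
      then show ?thesis using Cons.IH[OF _ u] by simp
    next
      case (down w')
      then show ?thesis
        using Cons.IH[OF _ u] Cons.prems(1) degree_smult_le[of z "F (Suc n) (w @ u)"]
        by (metis degree_add_le le_trans)
    qed
  qed
  show ?case using main[OF Nil_in_normal_forms step.prems] by simp
qed

text \<open>A nonempty last run contributes a factor T and kills the constant term. Otherwise the
  word already lives on one strand fewer, down to the empty word.\<close>

lemma coeff_0_normal_form:
  assumes "n \<ge> 1" "w \<in> normal_forms n"
  shows "coeff (F n w) 0 = (if w = [] then 1 else 0)"
  using assms
proof (induction n arbitrary: w rule: dec_induct)
  case base
  then have "w = []" using normal_forms_set by fastforce
  then show ?case by (simp add: empty)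
next
  case (step n)
  from step.hyps(1) step.prems show ?case
    by (cases rule: normal_form_cases) (simp_all add: step.IH)
qed

text \<open>Induction strips the last letter s of u, which is the first letter of
  \<open>rev u\<close>, and lets w absorb it. Keeping w in normal form makes both outcomes of
  \<open>mult_cases\<close> instances of the induction hypothesis.\<close>

lemma orthonormal_normal_form:
  assumes "n \<ge> 1" "w \<in> normal_forms n" "reduced_expression n (perm_of u) u"
  shows "coeff (F n (w @ rev u)) 0 = (if perm_of w = perm_of u then 1 else 0)"
  using assms(2,3)
proof (induction u arbitrary: w rule: rev_induct)
  case Nil
  have "perm_of w = perm_of [] \<longleftrightarrow> w = []"
    using normal_form_unique[OF Nil(1) Nil_in_normal_forms] by blast
  then show ?case using coeff_0_normal_form[OF assms(1) Nil(1)] by (simp del: perm_of_Nil)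
next
  case (snoc s u)
  have u: "reduced_expression n (perm_of u) u"
    by (rule reduced_expression_snocD[OF snoc.prems(2)])
  \<comment> \<open>A transposition is an involution, so s moves from one side of an equation to the
    other, just as it moves from u to w.\<close>
  have perm_s: "p \<circ> perm_of [s] = q \<longleftrightarrow> p = q \<circ> perm_of [s]" for p q
    using perm_of_square[of s] by (auto simp: comp_assoc)
  have set_u: "set (s # rev u) \<subseteq> {1..<n}"
    using snoc.prems(2) by (auto simp: reduced_expression_def)
  from assms(1) snoc.prems(1) set_u show ?case
  proof (cases rule: mult_cases)
    case (up w')
    have "perm_of w' = perm_of u \<longleftrightarrow> perm_of w = perm_of (u @ [s])"
      using braid_eq_perm_of[OF up(2)] perm_s[of "perm_of w" "perm_of u"]
      by (simp del: perm_of_Cons)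
    then show ?thesis using snoc.IH[OF up(1) u] up(3) by (simp del: perm_of_append)
  next
    case (down w')
    \<comment> \<open>The term with factor \<open>z\<close> vanishes: if \<open>w\<close> and \<open>u\<close> had the same permutation, then cancelling
      the last letter \<open>s\<close> of \<open>w' s\<close> against that of \<open>u s\<close> would shorten the reduced word \<open>u s\<close>.\<close>
    have "perm_of w \<noteq> perm_of u"
    proof
      assume *: "perm_of w = perm_of u"
      \<comment> \<open>Equality of permutations has to become braid equivalence of words; the
        unique normal form provides this.\<close>
      obtain v where v: "v \<in> normal_forms n" "braid_eq u v"
        using reduced_expression_normal_form[OF u] by blast
      then have "v = w"
        using normal_form_unique[OF _ snoc.prems(1)] braid_eq_perm_of[OF v(2)] * by simp
      then have "braid_eq u (w' @ [s])" using v(2) down(2) by (blast intro: braid_eq.trans)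
      then show False
        using reduced_expression_no_cancel[OF snoc.prems(2) normal_forms_set[OF down(1)]] by blast
    qed
    moreover have "perm_of w' = perm_of u \<longleftrightarrow> perm_of w = perm_of (u @ [s])"
    proof -
      have "perm_of w = perm_of w' \<circ> perm_of [s]"
        using braid_eq_perm_of[OF down(2)] by simp
      then have "perm_of w' = perm_of w \<circ> perm_of [s]"
        using perm_s[of "perm_of w'" "perm_of w"] by metis
      then show ?thesis
        using perm_s[of "perm_of w" "perm_of u"] unfolding perm_of_append by metis
    qed
    ultimately show ?thesis
      using snoc.IH[OF down(1) u] snoc.IH[OF snoc.prems(1) u] down(3)
      by (simp del: perm_of_append)
  qed
qed

lemma orthonormal:
  assumes "n \<ge> 1" "reduced_expression n \<pi> u" "reduced_expression n \<kappa> v"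
  shows "coeff (F n (u @ rev v)) 0 = (if \<pi> = \<kappa> then 1 else 0)"
proof -
  have p: "perm_of u = \<pi>" "perm_of v = \<kappa>" "set (u @ rev v) \<subseteq> {1..<n}"
    using assms(2,3) by (auto simp: reduced_expression_def)
  obtain w where w: "w \<in> normal_forms n" "braid_eq u w"
    using reduced_expression_normal_form[of n u] assms(2) p(1) by blast
  have "F n (u @ rev v) = F n (w @ rev v)"
    using braid_eq_invariant[OF assms(1) _ p(3)] braid_eq_append[OF w(2) braid_eq.refl] by blast
  then show ?thesis
    using orthonormal_normal_form[OF assms(1) w(1), of v] assms(3) p braid_eq_perm_of[OF w(2)]
    by simp
qed

end

section \<open>Words, the free algebra and its quotient\<close>

section \<open>The Hecke algebra\<close>

lemma words_append: "u @ v \<in> words n \<longleftrightarrow> u \<in> words n \<and> v \<in> words n"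
  by (simp add: words_def)

lemma words_Nil: "[] \<in> words n"
  by (simp add: words_def)

lemma words_map_Sig: "map Sig u \<in> words n \<longleftrightarrow> set u \<subseteq> {1..<n}"
  by (auto simp: words_def in_lists_conv_set subset_iff)

lemma words_mono: "m \<le> n \<Longrightarrow> words m \<subseteq> words n"
  unfolding words_def by (intro lists_mono) auto

lemma words_rev: "rev u \<in> words n \<longleftrightarrow> u \<in> words n"
  by (simp add: words_def in_lists_conv_set)

lemma braid_relations_words: "(l, r) \<in> braid_relations n \<Longrightarrow> l \<in> words n \<and> r \<in> words n"
  by (induction rule: braid_relations.induct) (auto simp: words_def)

lemma braid_relations_mono: "m \<le> n \<Longrightarrow> braid_relations m \<subseteq> braid_relations n"
proof
  fix p assume "m \<le> n" "p \<in> braid_relations m"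
  then show "p \<in> braid_relations n"
    by (cases p) (auto elim!: braid_relations.cases intro!: braid_relations.intros)
qed

lemma free_algebra_simps [simp]:
  "carrier (free_algebra n) = {f. Poly_Mapping.keys f \<subseteq> words n}"
  "f \<otimes>\<^bsub>free_algebra n\<^esub> g = f * g" "f \<oplus>\<^bsub>free_algebra n\<^esub> g = f + g"
  "\<one>\<^bsub>free_algebra n\<^esub> = 1" "\<zero>\<^bsub>free_algebra n\<^esub> = 0"
  by (simp_all add: free_algebra_def)

lemma free_algebra_closed:
  "f \<in> carrier (free_algebra n) \<Longrightarrow> g \<in> carrier (free_algebra n) \<Longrightarrow> f + g \<in> carrier (free_algebra n)"
  "f \<in> carrier (free_algebra n) \<Longrightarrow> g \<in> carrier (free_algebra n) \<Longrightarrow> f * g \<in> carrier (free_algebra n)"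
  "f \<in> carrier (free_algebra n) \<Longrightarrow> - f \<in> carrier (free_algebra n)"
  "f \<in> carrier (free_algebra n) \<Longrightarrow> g \<in> carrier (free_algebra n) \<Longrightarrow> f - g \<in> carrier (free_algebra n)"
  "u \<in> words n \<Longrightarrow> Poly_Mapping.single u c \<in> carrier (free_algebra n)"
proof -
  show add: "f + g \<in> carrier (free_algebra n)"
    if "f \<in> carrier (free_algebra n)" "g \<in> carrier (free_algebra n)" for f g
    using that keys_add[of f g] by auto
  show "f * g \<in> carrier (free_algebra n)"
    if "f \<in> carrier (free_algebra n)" "g \<in> carrier (free_algebra n)"
    using that keys_mult[of f g] by (fastforce simp: plus_list_def words_append)
  show neg: "- f \<in> carrier (free_algebra n)" if "f \<in> carrier (free_algebra n)" for f
    using that by (auto simp: in_keys_iff subset_iff)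
  show "f - g \<in> carrier (free_algebra n)"
    if "f \<in> carrier (free_algebra n)" "g \<in> carrier (free_algebra n)"
    using add[OF that(1) neg[OF that(2)]] by simp
  show "Poly_Mapping.single u c \<in> carrier (free_algebra n)" if "u \<in> words n"
    using that by simp
qed

lemma free_word_Nil: "free_word [] = 1"
  by (simp flip: single_one add: zero_list_def)

lemma ring_free_algebra: "ring (free_algebra n)"
proof (rule ringI)
  show "abelian_group (free_algebra n)"
  proof (rule abelian_groupI)
    show "\<exists>g\<in>carrier (free_algebra n). g \<oplus>\<^bsub>free_algebra n\<^esub> f = \<zero>\<^bsub>free_algebra n\<^esub>"
      if "f \<in> carrier (free_algebra n)" for f
      using free_algebra_closed(3)[OF that] by (intro bexI[of _ "- f"]) simp_all
  qed (use free_algebra_closed(1) in \<open>auto simp: algebra_simps\<close>)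
  show "monoid (free_algebra n)"
    by (rule monoidI)
      (use free_algebra_closed(2) in \<open>auto simp: algebra_simps words_Nil zero_list_def\<close>)
qed (simp_all add: algebra_simps)

lemma a_inv_free_algebra:
  assumes "f \<in> carrier (free_algebra n)"
  shows "\<ominus>\<^bsub>free_algebra n\<^esub> f = - f"
proof -
  interpret ring "free_algebra n" by (rule ring_free_algebra)
  show ?thesis
    using minus_equality[of "- f" f] assms free_algebra_closed(3)[OF assms] by simp
qed

lemma a_minus_free_algebra:
  assumes "g \<in> carrier (free_algebra n)"
  shows "f \<ominus>\<^bsub>free_algebra n\<^esub> g = f - g"
  unfolding a_minus_def a_inv_free_algebra[OF assms] by simp

lemma hecke_relators_closed: "hecke_relators n \<subseteq> carrier (free_algebra n)"
proof
  fix f assume "f \<in> hecke_relators n"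
  then show "f \<in> carrier (free_algebra n)"
    unfolding hecke_relators_def
    using braid_relations_words[of _ _ n]
    by (auto intro!: free_algebra_closed(4,5) simp del: free_algebra_simps simp: words_Nil)
      (auto simp: words_def)
qed

lemma ideal_hecke_ideal: "ideal (hecke_ideal n) (free_algebra n)"
  unfolding hecke_ideal_def by (rule ring.genideal_ideal[OF ring_free_algebra hecke_relators_closed])

lemma hecke_relators_in_ideal: "hecke_relators n \<subseteq> hecke_ideal n"
  unfolding hecke_ideal_def by (rule ring.genideal_self[OF ring_free_algebra hecke_relators_closed])

text \<open>The larger ideal intersected with the smaller free algebra is an ideal there and
  contains its relators, so minimality of the generated ideal applies.\<close>

lemma hecke_ideal_mono: "hecke_ideal n \<subseteq> hecke_ideal (Suc n)"
proof -
  let ?J = "hecke_ideal (Suc n) \<inter> carrier (free_algebra n)"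
  interpret I: ideal "hecke_ideal (Suc n)" "free_algebra (Suc n)" by (rule ideal_hecke_ideal)
  interpret R: ring "free_algebra n" by (rule ring_free_algebra)
  have sub: "carrier (free_algebra n) \<subseteq> carrier (free_algebra (Suc n))"
    using words_mono[of n "Suc n"] by auto
  \<comment> \<open>Negation is multiplication by the ring element -1.\<close>
  have neg: "- f \<in> hecke_ideal (Suc n)" if "f \<in> hecke_ideal (Suc n)" for f
    using I.I_l_closed[OF that free_algebra_closed(3)[OF I.one_closed]] by simp
  have add: "f + g \<in> hecke_ideal (Suc n)"
    if "f \<in> hecke_ideal (Suc n)" "g \<in> hecke_ideal (Suc n)" for f g
    using additive_subgroup.a_closed[OF I.additive_subgroup_axioms that]
    by (simp only: free_algebra_simps)
  have mult: "x * f \<in> hecke_ideal (Suc n)" "f * x \<in> hecke_ideal (Suc n)"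
    if "f \<in> hecke_ideal (Suc n)" "x \<in> carrier (free_algebra (Suc n))" for f x
    using I.I_l_closed[OF that] I.I_r_closed[OF that] by (simp_all only: free_algebra_simps)
  have "ideal ?J (free_algebra n)"
  proof (rule idealI)
    show "ring (free_algebra n)" ..
    show "subgroup ?J (add_monoid (free_algebra n))"
    proof (rule R.add.subgroupI)
      show "?J \<noteq> {}"
        using additive_subgroup.zero_closed[OF I.additive_subgroup_axioms] by auto
      show "\<ominus>\<^bsub>free_algebra n\<^esub> a \<in> ?J" if "a \<in> ?J" for a
        using that a_inv_free_algebra[of a n] neg[of a] free_algebra_closed(3)[of a n] by auto
      show "a \<oplus>\<^bsub>free_algebra n\<^esub> b \<in> ?J" if "a \<in> ?J" "b \<in> ?J" for a b
        using that add[of a b] free_algebra_closed(1)[of a n b] by simp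
    qed auto
    show "x \<otimes>\<^bsub>free_algebra n\<^esub> a \<in> ?J" if "a \<in> ?J" "x \<in> carrier (free_algebra n)" for a x
      using mult(1)[of a x] that sub free_algebra_closed(2)[of x n a] by auto
    show "a \<otimes>\<^bsub>free_algebra n\<^esub> x \<in> ?J" if "a \<in> ?J" "x \<in> carrier (free_algebra n)" for a x
      using mult(2)[of a x] that sub free_algebra_closed(2)[of a n x] by auto
  qed
  moreover have "hecke_relators n \<subseteq> ?J"
  proof -
    have "hecke_relators n \<subseteq> hecke_relators (Suc n)"
      unfolding hecke_relators_def
    proof (rule Un_mono)
      show "{free_word l - free_word r | l r. (l, r) \<in> braid_relations n} \<subseteq>
          {free_word l - free_word r | l r. (l, r) \<in> braid_relations (Suc n)}"
        using braid_relations_mono[OF le_SucI[OF le_refl], of n] by blast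
      show "{free_word [Sig i] - free_word [SigInv i] - free_const zvar | i. i \<in> {1..<n}} \<subseteq>
          {free_word [Sig i] - free_word [SigInv i] - free_const zvar | i. i \<in> {1..<Suc n}}"
        by (simp only: atLeastLessThan_iff) (blast intro: less_SucI)
    qed
    then show ?thesis
      using hecke_relators_in_ideal[of "Suc n"] hecke_relators_closed[of n] by blast
  qed
  ultimately have "hecke_ideal n \<subseteq> ?J"
    unfolding hecke_ideal_def[of n] by (rule R.genideal_minimal)
  then show ?thesis by simp
qed

lemma hecke_of_hom: "ring_hom_ring (free_algebra n) (hecke n) (hecke_of n)"
  unfolding hecke_def hecke_of_def[abs_def]
  using ideal.rcos_ring_hom_ring[OF ideal_hecke_ideal] .

lemma hecke_of_eqI:
  assumes "f \<in> carrier (free_algebra n)" "g \<in> carrier (free_algebra n)" "f - g \<in> hecke_ideal n"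
  shows "hecke_of n f = hecke_of n g"
  unfolding hecke_of_def
  using ring.quotient_eq_iff_same_a_r_cos[OF ring_free_algebra ideal_hecke_ideal assms(1,2)] assms
  by (simp only: a_minus_free_algebra)

lemma hecke_of_context:
  assumes "f \<in> carrier (free_algebra n)" "g \<in> carrier (free_algebra n)"
    "a \<in> carrier (free_algebra n)" "b \<in> carrier (free_algebra n)"
    "hecke_of n f = hecke_of n g"
  shows "hecke_of n (a * f * b) = hecke_of n (a * g * b)"
proof -
  interpret h: ring_hom_ring "free_algebra n" "hecke n" "hecke_of n" by (rule hecke_of_hom)
  have hom: "hecke_of n (a * x * b) = hecke_of n a \<otimes>\<^bsub>hecke n\<^esub> hecke_of n x \<otimes>\<^bsub>hecke n\<^esub> hecke_of n b"
    if "x \<in> carrier (free_algebra n)" for x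
    using h.hom_mult[of "a * x" b] h.hom_mult[of a x] assms free_algebra_closed(2) that
    by simp
  show ?thesis unfolding hom[OF assms(1)] hom[OF assms(2)] assms(5) ..
qed

lemma free_word_append: "free_word (u @ v) = free_word u * free_word v"
  by (simp add: mult_single plus_list_def)

lemma hecke_of_relation:
  assumes "(l, r) \<in> braid_relations n" "u \<in> words n" "v \<in> words n"
  shows "hecke_of n (free_word (u @ l @ v)) = hecke_of n (free_word (u @ r @ v))"
proof -
  have w: "l \<in> words n" "r \<in> words n" using braid_relations_words[OF assms(1)] by auto
  have "free_word l - free_word r \<in> hecke_relators n"
    unfolding hecke_relators_def using assms(1) by blast
  then have "hecke_of n (free_word l) = hecke_of n (free_word r)"
    using hecke_relators_in_ideal[of n] free_algebra_closed(5) w by (intro hecke_of_eqI) blast+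
  from hecke_of_context[OF _ _ _ _ this, of "free_word u" "free_word v"]
  show ?thesis
    using w assms(2,3) free_algebra_closed(5)[of _ n 1]
    by (simp only: free_word_append mult.assoc)
qed

text \<open>The second generator is replaced by its inverse plus z, and the first one then cancels
  the inverse.\<close>

lemma hecke_of_quadratic:
  assumes i: "i \<in> {1..<n}" and u: "u \<in> words n" and v: "v \<in> words n"
  shows "hecke_of n (free_word (u @ [Sig i, Sig i] @ v)) =
    hecke_of n (free_word (u @ v) + Poly_Mapping.single (u @ [Sig i] @ v) zvar)"
proof -
  let ?C = "carrier (free_algebra n)"
  have S: "[Sig i] \<in> words n" "[SigInv i] \<in> words n" "[Sig i, SigInv i] \<in> words n"
    using i by (auto simp: words_def)
  note cl = free_algebra_closed
  interpret h: ring_hom_ring "free_algebra n" "hecke n" "hecke_of n" by (rule hecke_of_hom)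
  let ?s = "free_word [Sig i]" and ?t = "free_word [SigInv i]" and ?z = "free_const zvar"
  let ?us = "free_word (u @ [Sig i])" and ?v = "free_word v"
  have closed: "?s \<in> ?C" "?t \<in> ?C" "?z \<in> ?C" "?us \<in> ?C" "?v \<in> ?C"
    using S u v words_Nil words_append by (blast intro: cl(5))+
  have "?s - (?t + ?z) \<in> hecke_relators n"
    unfolding hecke_relators_def diff_diff_add[symmetric] using i by blast
  then have q: "hecke_of n ?s = hecke_of n (?t + ?z)"
    using hecke_relators_in_ideal[of n] closed(1) cl(1)[OF closed(2,3)] by (intro hecke_of_eqI) blast+
  have hom: "hecke_of n (free_word a + Poly_Mapping.single b c) =
      hecke_of n (free_word a) \<oplus>\<^bsub>hecke n\<^esub> hecke_of n (Poly_Mapping.single b c)"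
    if "a \<in> words n" "b \<in> words n" for a b c
    using h.hom_add[OF cl(5)[OF that(1)] cl(5)[OF that(2)], of 1 c] by simp
  have w: "u @ v \<in> words n" "u @ [Sig i, SigInv i] @ v \<in> words n" "u @ [Sig i] @ v \<in> words n"
    using u v S by (simp_all only: words_append)
  have "free_word (u @ [Sig i, Sig i] @ v) = ?us * ?s * ?v"
    by (simp add: mult_single plus_list_def)
  also have "hecke_of n \<dots> = hecke_of n (?us * (?t + ?z) * ?v)"
    by (rule hecke_of_context[OF closed(1) cl(1)[OF closed(2,3)] closed(4,5) q])
  also have "?us * (?t + ?z) * ?v =
      free_word (u @ [Sig i, SigInv i] @ v) + Poly_Mapping.single (u @ [Sig i] @ v) zvar"
    by (simp add: distrib_left distrib_right mult_single plus_list_def)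
  also have "hecke_of n \<dots> = hecke_of n (free_word (u @ v)) \<oplus>\<^bsub>hecke n\<^esub>
      hecke_of n (Poly_Mapping.single (u @ [Sig i] @ v) zvar)"
    using hecke_of_relation[OF braid_relations.inv_right[OF i] u v] hom[OF w(2,3)] by simp
  finally show ?thesis using hom[OF w(1,3)] by simp
qed

text \<open>Two representatives of a coset differ by an element of the smaller ideal, which lies in
  the larger one. Hence all cosets in the union defining \<open>hecke_incl\<close> coincide.\<close>

lemma hecke_incl_hecke_of:
  assumes "f \<in> carrier (free_algebra n)"
  shows "hecke_incl n (hecke_of n f) = hecke_of (Suc n) f"
proof -
  interpret I: ideal "hecke_ideal n" "free_algebra n" by (rule ideal_hecke_ideal)
  have sub: "carrier (free_algebra n) \<subseteq> carrier (free_algebra (Suc n))"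
    using words_mono[of n "Suc n"] by auto
  have "hecke_of (Suc n) g = hecke_of (Suc n) f" if "g \<in> hecke_of n f" for g
  proof -
    from that obtain i where i: "i \<in> hecke_ideal n" "g = i + f"
      unfolding hecke_of_def a_r_coset_def' by auto
    show ?thesis
      by (rule hecke_of_eqI)
        (use i sub assms hecke_ideal_mono[of n] I.Icarr[OF i(1)] free_algebra_closed(1)[of i n f]
          in auto)
  qed
  moreover have "f \<in> hecke_of n f"
    unfolding hecke_of_def by (rule I.a_rcos_self[OF assms])
  ultimately show ?thesis unfolding hecke_incl_def by blast
qed

section \<open>Braids as classes of words, and their images in the Hecke algebra\<close>

section \<open>Braids\<close>

lemma braid_cong_words: "(u, v) \<in> braid_cong n \<Longrightarrow> u \<in> words n \<and> v \<in> words n"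
  by (induction rule: braid_cong.induct) (auto simp: words_append dest: braid_relations_words)

lemma equiv_braid_cong: "equiv (words n) (braid_cong n)"
proof (rule equivI)
  show "braid_cong n \<subseteq> words n \<times> words n" using braid_cong_words by auto
  show "refl_on (words n) (braid_cong n)" by (simp add: refl_onI braid_cong.refl)
  show "sym (braid_cong n)" by (rule symI) (rule braid_cong.sym)
  show "trans (braid_cong n)" by (rule transI) (rule braid_cong.trans)
qed

lemma braid_cong_context:
  assumes "(u, v) \<in> braid_cong n" "x \<in> words n" "y \<in> words n"
  shows "(x @ u @ y, x @ v @ y) \<in> braid_cong n"
  using assms(1)
proof (induction rule: braid_cong.induct)
  case (refl w)
  then show ?case using assms by (auto intro: braid_cong.refl simp: words_append)
next
  case (rel l r u v)
  then show ?case
    using assms braid_cong.rel[of l r n "x @ u" "v @ y"] by (simp add: words_append)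
next
  case (sym u v)
  then show ?case by (blast intro: braid_cong.sym)
next
  case (trans u v w)
  then show ?case by (blast intro: braid_cong.trans)
qed

lemma braid_cong_append:
  assumes "(u, v) \<in> braid_cong n" "(u', v') \<in> braid_cong n"
  shows "(u @ u', v @ v') \<in> braid_cong n"
proof (rule braid_cong.trans)
  show "(u @ u', v @ u') \<in> braid_cong n"
    using braid_cong_context[OF assms(1) words_Nil, of u'] braid_cong_words[OF assms(2)] by simp
  show "(v @ u', v @ v') \<in> braid_cong n"
    using braid_cong_context[OF assms(2) _ words_Nil, of v] braid_cong_words[OF assms(1)] by simp
qed

text \<open>Reversal exchanges the two inverse relations, turns a commutation into the one with i
  and j exchanged, and leaves the palindromic sides of the braid relation alone.\<close>

lemma braid_relations_rev:
  "(l, r) \<in> braid_relations n \<Longrightarrow> (rev l, rev r) \<in> braid_relations n"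
proof (induction rule: braid_relations.induct)
  case (far_comm i j)
  then show ?case using braid_relations.far_comm[of j n i] by auto
next
  case (braid i)
  then show ?case using braid_relations.braid[of i n] by simp
qed (simp_all add: braid_relations.inv_left braid_relations.inv_right)

lemma braid_cong_rev: "(u, v) \<in> braid_cong n \<Longrightarrow> (rev u, rev v) \<in> braid_cong n"
proof (induction rule: braid_cong.induct)
  case (rel l r u v)
  then have w: "rev u \<in> words n" "rev v \<in> words n" by (simp_all add: words_rev)
  show ?case
    using braid_cong.rel[OF braid_relations_rev[OF rel(1)] w(2,1)] by simp
next
  case (refl w)
  then show ?case by (simp add: braid_cong.refl words_rev)
next
  case (sym u w)
  then show ?case by (blast intro: braid_cong.sym)
next
  case (trans u v w)
  then show ?case by (blast intro: braid_cong.trans)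
qed

lemma braid_of_eq: "(u, v) \<in> braid_cong n \<Longrightarrow> braid_of n u = braid_of n v"
  unfolding braid_of_def by (rule equiv_class_eq[OF equiv_braid_cong])

lemma braid_of_self: "u \<in> words n \<Longrightarrow> u \<in> braid_of n u"
  unfolding braid_of_def by (simp add: braid_cong.refl)

text \<open>The nested union over representatives collapses, since concatenation and reversal
  respect the congruence.\<close>

lemma braid_mult_reverse:
  assumes "u \<in> words n" "v \<in> words n"
  shows "braid_of n u \<otimes>\<^bsub>braid_group n\<^esub> braid_reverse (braid_of n v) = braid_of n (u @ rev v)"
proof -
  have "braid_of n (u' @ rev v') = braid_of n (u @ rev v)"
    if "u' \<in> braid_of n u" "v' \<in> braid_of n v" for u' v'
  proof (rule braid_of_eq, rule braid_cong_append)
    show "(u', u) \<in> braid_cong n"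
      using that(1) braid_cong.sym unfolding braid_of_def by blast
    show "(rev v', rev v) \<in> braid_cong n"
      using that(2) braid_cong.sym braid_cong_rev unfolding braid_of_def by blast
  qed
  moreover have "u \<in> braid_of n u" "v \<in> braid_of n v"
    using assms by (simp_all add: braid_of_self)
  ultimately have "(\<Union>u'\<in>braid_of n u. \<Union>v'\<in>braid_of n v. braid_of n (u' @ rev v')) =
      braid_of n (u @ rev v)"
    by blast
  then show ?thesis
    by (simp add: braid_group_def braid_reverse_def)
qed

lemma hecke_of_braid_cong:
  "(u, v) \<in> braid_cong n \<Longrightarrow> hecke_of n (free_word u) = hecke_of n (free_word v)"
  by (induction rule: braid_cong.induct) (auto simp: hecke_of_relation)

lemma hecke_of_braid_braid_of:
  assumes "u \<in> words n"
  shows "hecke_of_braid n (braid_of n u) = hecke_of n (free_word u)"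
proof -
  have "hecke_of n (free_word v) = hecke_of n (free_word u)" if "v \<in> braid_of n u" for v
    using that hecke_of_braid_cong[of u v n] unfolding braid_of_def by simp
  then show ?thesis
    unfolding hecke_of_braid_def using braid_of_self[OF assms] by blast
qed

text \<open>Positive words are mapped through the free algebra into the quotient; each locale axiom
  then comes from a defining relation or a trace property.\<close>

lemma ocneanu_trace_word_trace:
  assumes "ocneanu_trace Tr"
  shows "word_trace (\<lambda>n u. Tr n (hecke_of n (free_word (map Sig u)))) zvar"
proof
  fix n :: nat and u v :: "nat list"
  assume n: "n \<ge> 1"
  interpret h: ring_hom_ring "free_algebra n" "hecke n" "hecke_of n" by (rule hecke_of_hom)
  have cl: "hecke_of n f \<in> carrier (hecke n)" if "f \<in> carrier (free_algebra n)" for f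
    using h.hom_closed[OF that] .
  have tr:
    "\<And>x y. x \<in> carrier (hecke n) \<Longrightarrow> y \<in> carrier (hecke n) \<Longrightarrow> Tr n (x \<oplus>\<^bsub>hecke n\<^esub> y) = Tr n x + Tr n y"
    "\<And>c x. x \<in> carrier (hecke n) \<Longrightarrow> Tr n (hecke_smult n c x) = smult c (Tr n x)"
    "\<And>x. x \<in> carrier (hecke n) \<Longrightarrow> Tr (Suc n) (hecke_incl n x) = Tr n x"
    "Tr n \<one>\<^bsub>hecke n\<^esub> = 1"
    "\<And>x y. x \<in> carrier (hecke n) \<Longrightarrow> y \<in> carrier (hecke n) \<Longrightarrow>
      Tr n (x \<otimes>\<^bsub>hecke n\<^esub> y) = Tr n (y \<otimes>\<^bsub>hecke n\<^esub> x)"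
    "\<And>x. x \<in> carrier (hecke n) \<Longrightarrow>
      Tr (Suc n) (hecke_incl n x \<otimes>\<^bsub>hecke (Suc n)\<^esub> hecke_of (Suc n) (free_word [Sig n])) =
        [:0, 1:] * Tr n x"
    using assms n unfolding ocneanu_trace_def by blast+
  show "Tr n (hecke_of n (free_word (map Sig (u @ [i, j] @ v)))) =
      Tr n (hecke_of n (free_word (map Sig (u @ [j, i] @ v))))"
    if "set (u @ [i, j] @ v) \<subseteq> {1..<n}" "i + 2 \<le> j" for i j
    using that hecke_of_relation[OF braid_relations.far_comm, of i n j "map Sig u" "map Sig v"]
    by (simp add: words_map_Sig)
  show "Tr n (hecke_of n (free_word (map Sig (u @ [i, Suc i, i] @ v)))) =
      Tr n (hecke_of n (free_word (map Sig (u @ [Suc i, i, Suc i] @ v))))"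
    if "set (u @ [i, Suc i, i] @ v) \<subseteq> {1..<n}" for i
    using that hecke_of_relation[OF braid_relations.braid, of i n "map Sig u" "map Sig v"]
    by (simp add: words_map_Sig)
  show "Tr n (hecke_of n (free_word (map Sig (u @ [i, i] @ v)))) =
      Tr n (hecke_of n (free_word (map Sig (u @ v)))) +
      smult zvar (Tr n (hecke_of n (free_word (map Sig (u @ [i] @ v)))))"
    if "set (u @ [i, i] @ v) \<subseteq> {1..<n}" for i
  proof -
    let ?u = "map Sig u" and ?v = "map Sig v"
    have w: "?u @ ?v \<in> words n" "?u @ [Sig i] @ ?v \<in> words n" "?u \<in> words n" "?v \<in> words n"
      "i \<in> {1..<n}"
      using that words_map_Sig[of "u @ v" n] words_map_Sig[of "u @ [i] @ v" n]
      by (simp_all add: words_map_Sig)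
    \<comment> \<open>The coefficient z is split off as a constant so that the term becomes a scalar
      multiple, as linearity of the trace requires.\<close>
    have "Poly_Mapping.single (?u @ [Sig i] @ ?v) zvar = free_const zvar * free_word (?u @ [Sig i] @ ?v)"
      by (simp add: mult_single plus_list_def)
    then have smult: "hecke_of n (Poly_Mapping.single (?u @ [Sig i] @ ?v) zvar) =
        hecke_smult n zvar (hecke_of n (free_word (?u @ [Sig i] @ ?v)))"
      unfolding hecke_smult_def
      using h.hom_mult[of "free_const zvar" "free_word (?u @ [Sig i] @ ?v)"] w words_Nil by simp
    have "Tr n (hecke_of n (free_word (?u @ [Sig i, Sig i] @ ?v))) =
        Tr n (hecke_of n (free_word (?u @ ?v)) \<oplus>\<^bsub>hecke n\<^esub>
          hecke_of n (Poly_Mapping.single (?u @ [Sig i] @ ?v) zvar))"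
      using hecke_of_quadratic[OF w(5,3,4)] w h.hom_add[of "free_word (?u @ ?v)"
        "Poly_Mapping.single (?u @ [Sig i] @ ?v) zvar"]
      by simp
    also have "\<dots> = Tr n (hecke_of n (free_word (?u @ ?v))) +
        smult zvar (Tr n (hecke_of n (free_word (?u @ [Sig i] @ ?v))))"
      using tr(1,2) cl w smult free_algebra_closed(5) by metis
    finally show ?thesis by simp
  qed
  show "Tr n (hecke_of n (free_word (map Sig (u @ v)))) =
      Tr n (hecke_of n (free_word (map Sig (v @ u))))" if "set (u @ v) \<subseteq> {1..<n}"
  proof -
    have w: "free_word (map Sig u) \<in> carrier (free_algebra n)"
        "free_word (map Sig v) \<in> carrier (free_algebra n)"
      using that by (simp_all add: words_map_Sig)
    show ?thesis
      using h.hom_mult[OF w] h.hom_mult[OF w(2,1)] tr(5)[OF cl cl, OF w]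
      by (simp add: free_word_append)
  qed
  show "Tr (Suc n) (hecke_of (Suc n) (free_word (map Sig u))) =
      Tr n (hecke_of n (free_word (map Sig u)))" if "set u \<subseteq> {1..<n}"
  proof -
    have w: "free_word (map Sig u) \<in> carrier (free_algebra n)"
      using that by (simp add: words_map_Sig)
    show ?thesis using tr(3)[OF cl[OF w]] hecke_incl_hecke_of[OF w] by simp
  qed
  show "Tr (Suc n) (hecke_of (Suc n) (free_word (map Sig (u @ [n])))) =
      [:0, 1:] * Tr n (hecke_of n (free_word (map Sig u)))" if "set u \<subseteq> {1..<n}"
  proof -
    interpret h': ring_hom_ring "free_algebra (Suc n)" "hecke (Suc n)" "hecke_of (Suc n)"
      by (rule hecke_of_hom)
    have w: "free_word (map Sig u) \<in> carrier (free_algebra n)"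
      using that by (simp add: words_map_Sig)
    have w': "free_word (map Sig u) \<in> carrier (free_algebra (Suc n))"
        "free_word [Sig n] \<in> carrier (free_algebra (Suc n))"
      using that n words_map_Sig[of u "Suc n"] words_map_Sig[of "[n]" "Suc n"] by auto
    show ?thesis
      using tr(6)[OF cl[OF w]] hecke_incl_hecke_of[OF w] h'.hom_mult[OF w']
      by (simp add: free_word_append)
  qed
  show "Tr n (hecke_of n (free_word (map Sig []))) = 1"
    using tr(4) h.hom_one by (simp add: free_word_Nil)
qed

section \<open>Extraction of one coefficient in v\<close>

section \<open>The coefficient of \<open>v ^ (n - 1)\<close> in the framed Homfly polynomial\<close>

lemma embed_z_0_1:
  "embed_z 0 = 0" "embed_z 1 = 1"
  by (simp_all add: embed_z_def Zero_fract_def One_fract_def)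

lemma embed_z_zvar_nonzero: "embed_z zvar \<noteq> 0"
  by (simp add: embed_z_def Zero_fract_def eq_fract)

text \<open>As a polynomial the power has degree 2k, so position 2N holds its leading coefficient
  when k = N and lies beyond its degree when k < N.\<close>

lemma one_minus_X2_power_nth:
  assumes "k \<le> N"
  shows "fls_nth ((1 - fls_X\<^sup>2 :: 'a::field fls) ^ k) (2 * int N) = (if k = N then (-1) ^ N else 0)"
proof -
  let ?p = "[:1, 0, -1:] :: 'a poly"
  have "fps_to_fls (fps_of_poly ?p) = 1 - fls_X\<^sup>2"
    by (simp add: fps_of_poly_pCons power2_eq_square fls_times_fps_to_fls)
  then have "(1 - fls_X\<^sup>2 :: 'a fls) ^ k = fps_to_fls (fps_of_poly (?p ^ k))"
    by (simp add: fps_of_poly_power fps_to_fls_power)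
  then have "fls_nth ((1 - fls_X\<^sup>2 :: 'a fls) ^ k) (2 * int N) = coeff (?p ^ k) (2 * N)"
    by (simp add: nat_mult_distrib)
  moreover have deg: "degree (?p ^ k) = 2 * k"
    by (simp add: degree_power_eq)
  moreover have "coeff (?p ^ k) (2 * N) = (if k = N then (-1) ^ N else 0)"
  proof (cases "k = N")
    case True
    then show ?thesis using lead_coeff_power[of ?p k] deg by simp
  next
    case False
    then show ?thesis using assms deg by (simp add: coeff_eq_0)
  qed
  ultimately show ?thesis by simp
qed

lemma homfly_term_nth:
  fixes c z :: "'a::field"
  assumes "i \<le> N" "z \<noteq> 0"
  shows "fls_nth (((inverse fls_X - fls_X) / fls_const z) ^ N *
      (fls_const c * (fls_const z / (1 - fls_X\<^sup>2)) ^ i)) (int N) =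
    (if i = 0 then (-1) ^ N * c / z ^ N else 0)"
proof -
  let ?d = "1 - fls_X\<^sup>2 :: 'a fls" and ?z = "fls_const z"
  \<comment> \<open>The constant coefficient of 1 - v^2 is 1, so the denominator is not
    zero.\<close>
  have "fls_nth ?d 0 \<noteq> fls_nth 0 0"
    by (simp add: fls_X_power_nth)
  then have d: "?d \<noteq> 0" by metis
  have z: "?z \<noteq> 0" using assms(2) by simp
  \<comment> \<open>Factoring v^(-1) - v in this way cancels the denominators, since i is at most N.
    The factor v^(-N) shifts the wanted coefficient from v^N to v^(2N).\<close>
  have "inverse fls_X - fls_X = (fls_X_inv * ?d :: 'a fls)"
    by (simp add: algebra_simps power2_eq_square flip: fls_inverse_X)
  then have "((inverse fls_X - fls_X) / ?z) ^ N * (fls_const c * (?z / ?d) ^ i) =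
      fls_X_inv ^ N * (fls_const c * ?z ^ i * ?d ^ N / (?z ^ N * ?d ^ i))"
    by (simp add: power_divide power_mult_distrib)
  also have "\<dots> = fls_X_inv ^ N * (fls_const (c / z ^ (N - i)) * ?d ^ (N - i))"
  proof -
    have "?z ^ N = ?z ^ i * ?z ^ (N - i)" "?d ^ N = ?d ^ i * ?d ^ (N - i)"
      using assms(1) by (simp_all flip: power_add)
    moreover have "fls_const (c / z ^ (N - i)) = fls_const c / ?z ^ (N - i)"
      by (simp add: fls_const_divide_const flip: fls_const_power)
    ultimately show ?thesis using z d by (simp add: field_simps)
  qed
  finally have "fls_nth (((inverse fls_X - fls_X) / ?z) ^ N * (fls_const c * (?z / ?d) ^ i)) (int N) =
      c / z ^ (N - i) * fls_nth (?d ^ (N - i)) (2 * int N)"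
    by (simp add: fls_X_inv_power_times_conv_shift)
  also have "\<dots> = (if i = 0 then (-1) ^ N * c / z ^ N else 0)"
    using one_minus_X2_power_nth[of "N - i" N, where 'a = 'a] assms(1) by auto
  finally show ?thesis .
qed

text \<open>The degree bound makes \<open>homfly_term_nth\<close> applicable to every term; only i =
  0 survives, and (-z)^N cancels its factor (-1)^N / z^N.\<close>

lemma homfly_poly_nth:
  fixes p :: "int poly poly"
  assumes "degree p \<le> N"
  defines "z \<equiv> embed_z zvar"
  shows "(- z) ^ N * fls_nth (((inverse fls_X - fls_X) / fls_const z) ^ N *
      poly (map_poly (\<lambda>c. fls_const (embed_z c)) p) (fls_const z / (1 - fls_X\<^sup>2))) (int N) =
    embed_z (coeff p 0)"
proof -
  let ?x = "fls_const z / (1 - fls_X\<^sup>2)" and ?a = "((inverse fls_X - fls_X) / fls_const z) ^ N"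
  let ?e = "\<lambda>c. fls_const (embed_z c)"
  have z: "z \<noteq> 0" using embed_z_zvar_nonzero z_def by simp
  have e0: "?e 0 = 0" by (simp add: embed_z_0_1)
  \<comment> \<open>Zero coefficients pad the sum up to N, so the actual degree of the mapped
    polynomial does not matter.\<close>
  have "poly (map_poly ?e p) ?x = (\<Sum>i\<le>N. coeff (map_poly ?e p) i * ?x ^ i)"
    unfolding poly_altdef
    using le_trans[OF map_poly_degree_leq assms(1), of ?e]
    by (intro sum.mono_neutral_left) (auto simp: coeff_eq_0)
  then have "?a * poly (map_poly ?e p) ?x = (\<Sum>i\<le>N. ?a * (?e (coeff p i) * ?x ^ i))"
    by (simp add: sum_distrib_left coeff_map_poly e0)
  then have "fls_nth (?a * poly (map_poly ?e p) ?x) (int N) =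
      (\<Sum>i\<le>N. if i = 0 then (-1) ^ N * embed_z (coeff p i) / z ^ N else 0)"
    using homfly_term_nth[OF _ z, of _ N] by (simp add: fls_nth_sum)
  also have "\<dots> = (-1) ^ N * embed_z (coeff p 0) / z ^ N"
    by simp
  finally show ?thesis
    using z by (simp add: power_minus[of z])
qed

theorem mainTheorem2:
  fixes Tr :: "nat \<Rightarrow> hecke_elem \<Rightarrow> int poly poly" and n :: nat
  assumes "ocneanu_trace Tr" and "n \<ge> 1"
    and "\<pi> permutes {1..n}" and "\<kappa> permutes {1..n}"
  shows "right_inner Tr n (pos_perm_braid n \<pi>) (pos_perm_braid n \<kappa>) =
    (if \<pi> = \<kappa> then 1 else 0)"
proof -
  \<comment> \<open>The words chosen by \<open>SOME\<close> are reduced because reduced expressions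
    exist; nothing else about the choice enters.\<close>
  obtain u v where u: "pos_perm_braid n \<pi> = braid_of n (map Sig u)" "reduced_expression n \<pi> u"
    and v: "pos_perm_braid n \<kappa> = braid_of n (map Sig v)" "reduced_expression n \<kappa> v"
    unfolding pos_perm_braid_def
    using someI_ex[OF reduced_expression_exists[OF assms(3)]]
      someI_ex[OF reduced_expression_exists[OF assms(4)]] by blast
  interpret word_trace "\<lambda>n u. Tr n (hecke_of n (free_word (map Sig u)))" zvar
    by (rule ocneanu_trace_word_trace[OF assms(1)])
  let ?p = "Tr n (hecke_of n (free_word (map Sig (u @ rev v))))"
  have set: "set u \<subseteq> {1..<n}" "set v \<subseteq> {1..<n}"
    using u(2) v(2) by (simp_all add: reduced_expression_def)
  then have w: "map Sig u \<in> words n" "map Sig v \<in> words n" "map Sig (u @ rev v) \<in> words n"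
    unfolding words_map_Sig by simp_all
  have "hecke_of_braid n (pos_perm_braid n \<pi> \<otimes>\<^bsub>braid_group n\<^esub> braid_reverse (pos_perm_braid n \<kappa>)) =
      hecke_of n (free_word (map Sig (u @ rev v)))"
    using braid_mult_reverse[OF w(1,2)] hecke_of_braid_braid_of[OF w(3)]
    by (simp add: u(1) v(1) rev_map)
  moreover have "degree ?p \<le> n - 1"
    by (rule degree_le) (use assms(2) set in auto)
  ultimately have "right_inner Tr n (pos_perm_braid n \<pi>) (pos_perm_braid n \<kappa>) =
      embed_z (coeff ?p 0)"
    using homfly_poly_nth[of ?p "n - 1"]
    by (simp only: right_inner_def framed_homfly_def Let_def)
  then show ?thesis
    using orthonormal[OF assms(2) u(2) v(2)] by (simp add: embed_z_0_1)
qed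

end
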